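(* Let $n,m\ge 1$ be integers, $\mathcal{X}$ a set of inputs, $\boldsymbol{I}:\mathcal{X}\to\mathbb{R}^n$ the (known) feature map, and let $W_S=(w_{ij})\in\mathbb{R}^{n\times m}$ and $\boldsymbol{b}_S\in\mathbb{R}^m$ be the weight matrix and bias vector of the last layer of the student network, whose output is $\mathcal{O}_\theta(\boldsymbol{x})=\tanh(\boldsymbol{I}(\boldsymbol{x})^TW_S+\boldsymbol{b}_S)$ (applied componentwise). Let $i_0\in\{1,\dots,n\}$, $j_0\in\{1,\dots,m\}$, and let $\boldsymbol{x}\in\mathcal{X}$ be a non-vanishing input for $i_0$, i.e. $I_{i_0}:=I_{i_0}(\boldsymbol{x})\neq 0$. Let $z_{j_0}$ be the correct value of $\mathcal{O}_{\theta,j_0}(\boldsymbol{x})$, and let $\tilde z_{j_0}$ be the value of $\mathcal{O}_{\theta,j_0}(\boldsymbol{x})$ when a SNIFF on the weight $w_{i_0j_0}$ is carried out. Then \[ w_{i_0j_0}=\frac{1}{4I_{i_0}}\ln\frac{(1+z_{j_0})(1-\tilde z_{j_0})}{(1-z_{j_0})(1+\tilde z_{j_0})}. \]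
   Context: All computations are in exact real arithmetic. The student network consists of a fixed known feature map $\boldsymbol{I}=(I_1,\dots,I_n):\mathcal{X}\to\mathbb{R}^n$ (the first $k-1$ layers of a public teacher network) followed by one fully connected layer with weights $W_S\in\mathbb{R}^{n\times m}$ and biases $\boldsymbol{b}_S\in\mathbb{R}^m$. For an input $\boldsymbol{x}$, put $y_j(\boldsymbol{x})=b_{S,j}+\sum_{i=1}^n I_i(\boldsymbol{x})w_{ij}$ for $j=1,\dots,m$. With tanh activation the $j$-th output is $\mathcal{O}_{\theta,j}(\boldsymbol{x})=\dfrac{\exp(y_j(\boldsymbol{x}))-\exp(-y_j(\boldsymbol{x}))}{\exp(y_j(\boldsymbol{x}))+\exp(-y_j(\boldsymbol{x}))}$. SNIFF (sign bit flip fault) on the weight $w_{i_0j_0}$: during the execution on $\boldsymbol{x}$, the product $I_{i_0}(\boldsymbol{x})w_{i_0j_0}$ is replaced by $-I_{i_0}(\boldsymbol{x})w_{i_0j_0}$ in the computation of $y_{j_0}$; everything else is unchanged, and the activation is then applied. *)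

theory Defs
  imports "HOL-Analysis.Analysis"
begin

definition layer_product :: "('x \<Rightarrow> real ^ 'n) \<Rightarrow> real ^ 'm ^ 'n \<Rightarrow> 'x \<Rightarrow> 'n \<Rightarrow> 'm \<Rightarrow> real"
  where "layer_product F W x i j = F x $ i * W $ i $ j"

(* The same layer product computed in an execution in which the sign bit of the
   product belonging to the weight (i0, j0) is flipped; W itself is not modified. *)
definition sniff_product ::
    "'n \<Rightarrow> 'm \<Rightarrow> ('x \<Rightarrow> real ^ 'n) \<Rightarrow> real ^ 'm ^ 'n \<Rightarrow> 'x \<Rightarrow> 'n \<Rightarrow> 'm \<Rightarrow> real"
  where "sniff_product i0 j0 F W x i j =
    (if i = i0 \<and> j = j0 then - layer_product F W x i j else layer_product F W x i j)"

definition preactivation :: "real ^ 'm \<Rightarrow> ('n::finite \<Rightarrow> 'm \<Rightarrow> real) \<Rightarrow> real ^ 'm"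
  where "preactivation b p = (\<chi> j. b $ j + (\<Sum>i\<in>UNIV. p i j))"

definition student_output ::
    "('x \<Rightarrow> real ^ 'n) \<Rightarrow> real ^ 'm ^ 'n \<Rightarrow> real ^ 'm \<Rightarrow> 'x \<Rightarrow> real ^ 'm"
  where "student_output F W b x = (\<chi> j. tanh (preactivation b (layer_product F W x) $ j))"

definition sniff_output ::
    "'n \<Rightarrow> 'm \<Rightarrow> ('x \<Rightarrow> real ^ 'n) \<Rightarrow> real ^ 'm ^ 'n \<Rightarrow> real ^ 'm \<Rightarrow> 'x \<Rightarrow> real ^ 'm"
  where "sniff_output i0 j0 F W b x =
    (\<chi> j. tanh (preactivation b (sniff_product i0 j0 F W x) $ j))"

lemma student_output_matrix:
  "student_output F W b x = (\<chi> j. tanh ((F x v* W + b) $ j))"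
  by (simp add: student_output_def preactivation_def layer_product_def
      vector_matrix_mult_def mult.commute add.commute)

lemma tanh_real_exp_quotient:
  "tanh (y::real) = (exp y - exp (- y)) / (exp y + exp (- y))"
  unfolding tanh_def sinh_def cosh_def real_scaleR_def
  by (rule mult_divide_mult_cancel_left) simp

(* Both outputs lie strictly between -1 and 1, so quotients such as
   ((1 + z) * (1 - z')) / ((1 - z) * (1 + z')) have nonzero denominator and positive value. *)
lemma student_output_bounds:
  "- 1 < student_output F W b x $ j" "student_output F W b x $ j < 1"
  by (simp_all add: student_output_def tanh_real_gt_neg1 tanh_real_lt_1)

lemma sniff_output_bounds:
  "- 1 < sniff_output i0 j0 F W b x $ j" "sniff_output i0 j0 F W b x $ j < 1"
  by (simp_all add: sniff_output_def tanh_real_gt_neg1 tanh_real_lt_1)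

end

theory Submission
  imports Defs
begin

text \<open>A sign flip lowers the preactivation by \<open>2 * F x $ i0 * W $ i0 $ j0\<close>, and the inverse
  \<open>artanh u = ln ((1 + u) / (1 - u)) / 2\<close> of the activation recovers both preactivations from
  the two outputs.\<close>

lemma preactivation_sniff_product:
  "preactivation b (sniff_product i0 j0 F W x) $ j0 =
    preactivation b (layer_product F W x) $ j0 - 2 * layer_product F W x i0 j0"
proof -
  have "(\<Sum>i\<in>UNIV. sniff_product i0 j0 F W x i j0) =
      (\<Sum>i\<in>UNIV. layer_product F W x i j0 - (if i = i0 then 2 * layer_product F W x i0 j0 else 0))"
    by (rule sum.cong) (auto simp: sniff_product_def)
  then show ?thesis
    by (simp add: preactivation_def sum_subtractf)
qed

lemma ln_odds_ratio_artanh: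
  fixes u v :: real
  assumes "\<bar>u\<bar> < 1" "\<bar>v\<bar> < 1"
  shows "ln (((1 + u) * (1 - v)) / ((1 - u) * (1 + v))) = 2 * (artanh u - artanh v)"
proof -
  have "0 < 1 + u" "0 < 1 - u" "0 < 1 + v" "0 < 1 - v"
    using assms by auto
  then show ?thesis
    by (simp add: artanh_def ln_div ln_mult diff_divide_distrib)
qed

theorem theorem6:
  fixes X :: "'x set"
    and F :: "'x \<Rightarrow> real ^ 'n"
    and W :: "real ^ 'm ^ 'n"
    and b :: "real ^ 'm"
    and i0 :: 'n and j0 :: 'm
    and x :: 'x
    and z z' :: real
  assumes "x \<in> X"
    and "F x $ i0 \<noteq> 0"
    and "z = student_output F W b x $ j0"
    and "z' = sniff_output i0 j0 F W b x $ j0"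
  shows "W $ i0 $ j0 = 1 / (4 * F x $ i0) * ln (((1 + z) * (1 - z')) / ((1 - z) * (1 + z')))"
proof -
  let ?y = "preactivation b (layer_product F W x) $ j0"
  let ?y' = "preactivation b (sniff_product i0 j0 F W x) $ j0"
  have z: "z = tanh ?y" and z': "z' = tanh ?y'"
    using assms by (simp_all add: student_output_def sniff_output_def)
  have "\<bar>z\<bar> < 1" "\<bar>z'\<bar> < 1"
    by (simp_all add: z z' abs_less_iff tanh_real_lt_1 tanh_real_gt_neg1 minus_less_iff)
  then have "ln (((1 + z) * (1 - z')) / ((1 - z) * (1 + z'))) = 2 * (?y - ?y')"
    by (simp add: ln_odds_ratio_artanh z z' artanh_tanh_real)
  also have "\<dots> = 4 * F x $ i0 * W $ i0 $ j0"
    by (simp add: preactivation_sniff_product layer_product_def)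
  finally show ?thesis
    using assms(2) by simp
qed

end
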